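(* Let $\mathcal{X},\mathcal{Z}$ be finite sets, let $P_{XZ}$ be a probability distribution on $\mathcal{X}\times\mathcal{Z}$, and for each $n\ge1$ let $(X^n,Z^n)=((X_1,Z_1),\dots,(X_n,Z_n))$ be i.i.d. with common distribution $P_{XZ}$. Suppose $\sigma^2=\mathrm{Var}\left[\log\frac{1}{P_{X|Z}(X|Z)}\right]>0$. Then for every sequence of Slepian–Wolf codes $\{\Phi_n=(\phi_n,\psi_n)\}_{n\ge1}$ with $$\lim_{n\to\infty}\varepsilon(\Phi_n)=0$$ we have $$\lim_{n\to\infty}\Delta(\phi_n)=1 .$$
   Context: Logarithms are natural (base $e$). A Slepian–Wolf code (source coding of $X^n$ with full side-information $Z^n$ at the decoder) is a pair of an encoder $\phi_n:\mathcal{X}^n\to\mathcal{M}_n=\{1,\dots,M_n\}$ and a decoder $\psi_n:\mathcal{M}_n\times\mathcal{Z}^n\to\mathcal{X}^n$; its error probability is $\varepsilon(\Phi_n)=P_{X^nZ^n}(\{(x^n,z^n):\psi_n(\phi_n(x^n),z^n)\ne x^n\})$. For probability distributions $P,Q$ on a finite set $\mathcal{A}$, $d(P,Q)=\frac12\sum_{a\in\mathcal{A}}|P(a)-Q(a)|$. With $S_n=\phi_n(X^n)$ and $P_{U_n}$ the uniform distribution on $\mathcal{M}_n$, define $\Delta(\phi_n)=d(P_{S_nZ^n},P_{U_n}\times P_{Z^n})$. *)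

theory Defs
  imports "HOL-Probability.Probability"
begin

text \<open>
  Alphabets are types of class \<open>finite\<close>.  Sequences of length \<open>n\<close> are lists of length \<open>n\<close>, and the
  joint law of \<open>((X\<^sub>1, Z\<^sub>1), \<dots>, (X\<^sub>n, Z\<^sub>n))\<close>, i.i.d. with common law \<open>P\<close>, is \<open>replicate_pmf n P\<close>;
  on a sample \<open>xzs\<close> of it, \<open>X\<^sup>n\<close> is \<open>map fst xzs\<close> and \<open>Z\<^sup>n\<close> is \<open>map snd xzs\<close>.
\<close>

text \<open>The value at \<open>P\<^sub>Z(z) = 0\<close> is the junk value 0; it has no influence under \<open>P\<close>.\<close>

definition cond_prob :: "('x \<times> 'z) pmf \<Rightarrow> 'x \<Rightarrow> 'z \<Rightarrow> real" where
  "cond_prob P x z = pmf P (x, z) / pmf (map_pmf snd P) z"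

definition cond_information_variance :: "('x \<times> 'z) pmf \<Rightarrow> real" where
  "cond_information_variance P =
     measure_pmf.variance P (\<lambda>(x, z). ln (1 / cond_prob P x z))"

definition slepian_wolf_code ::
    "nat \<Rightarrow> nat \<Rightarrow> ('x list \<Rightarrow> nat) \<Rightarrow> (nat \<Rightarrow> 'z list \<Rightarrow> 'x list) \<Rightarrow> bool" where
  "slepian_wolf_code n M \<phi> \<psi> \<longleftrightarrow>
     (\<forall>xs. length xs = n \<longrightarrow> \<phi> xs \<in> {1..M}) \<and>
     (\<forall>m\<in>{1..M}. \<forall>zs. length zs = n \<longrightarrow> length (\<psi> m zs) = n)"

definition error_prob ::
    "('x \<times> 'z) pmf \<Rightarrow> nat \<Rightarrow> ('x list \<Rightarrow> nat) \<Rightarrow> (nat \<Rightarrow> 'z list \<Rightarrow> 'x list) \<Rightarrow> real" where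
  "error_prob P n \<phi> \<psi> =
     measure_pmf.prob (replicate_pmf n P)
       {xzs. \<psi> (\<phi> (map fst xzs)) (map snd xzs) \<noteq> map fst xzs}"

definition variational_distance :: "'a set \<Rightarrow> 'a pmf \<Rightarrow> 'a pmf \<Rightarrow> real" where
  "variational_distance A P Q = (1 / 2) * (\<Sum>a\<in>A. \<bar>pmf P a - pmf Q a\<bar>)"

definition security_distance ::
    "('x \<times> 'z) pmf \<Rightarrow> nat \<Rightarrow> nat \<Rightarrow> ('x list \<Rightarrow> nat) \<Rightarrow> real" where
  "security_distance P n M \<phi> =
     variational_distance ({1..M} \<times> {zs. length zs = n})
       (map_pmf (\<lambda>xzs. (\<phi> (map fst xzs), map snd xzs)) (replicate_pmf n P))
       (pair_pmf (pmf_of_set {1..M}) (map_pmf (map snd) (replicate_pmf n P)))"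

end

theory Submission
  imports Defs
begin

text \<open>
  Let \<open>W\<close> be the sum of the conditional information densities of the letters.  The overlap
  \<open>1 - \<Delta>\<close> of the law of \<open>(S, Z)\<close> with the ideal law is at most
  \<open>\<epsilon> + 2 exp (- c) + P (\<bar>W - ln M\<bar> \<le> c)\<close> for every \<open>c\<close>, because a decodable index is nearly
  as informative as \<open>X\<close> itself.  As \<open>W\<close> is a sum of \<open>n\<close> i.i.d. nonconstant variables, the last term
  tends to 0 for fixed \<open>c\<close>, uniformly in \<open>M\<close>.  In place of the central limit theorem, this uses that
  the mass of \<open>W\<close> in any interval of length \<open>2 c\<close> is bounded by a constant times the Gaussian
  average of \<open>\<bar>\<chi> u\<bar> ^ n\<close>, where the one-letter characteristic function satisfies \<open>\<bar>\<chi> u\<bar> < 1\<close>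
  for almost all \<open>u\<close>.
\<close>

section \<open>Laws of i.i.d. blocks\<close>

lemma replicate_pmf_Suc_map:
  "replicate_pmf (Suc n) p = bind_pmf p (\<lambda>x. map_pmf ((#) x) (replicate_pmf n p))"
  by (simp add: map_pmf_def)

lemma finite_set_replicate_pmf:
  assumes "finite (set_pmf p)"
  shows "finite (set_pmf (replicate_pmf n p))"
  using finite_lists_length_eq[OF assms, of n]
  by (simp add: set_replicate_pmf lists_eq_set conj_commute subset_iff)

lemma pmf_replicate_pmf:
  "pmf (replicate_pmf (length xs) p) xs = prod_list (map (pmf p) xs)"
proof (induction xs)
  case (Cons y xs)
  have "pmf (map_pmf ((#) x) (replicate_pmf (length xs) p)) (y # xs) =
      indicator {y} x * pmf (replicate_pmf (length xs) p) xs" for x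
  proof (cases "x = y")
    case True
    have "inj ((#) y)" by (auto intro: injI)
    with True show ?thesis
      using pmf_map_inj'[of "(#) y" "replicate_pmf (length xs) p" xs] by simp
  qed (auto intro: pmf_map_outside)
  then show ?case
    using Cons.IH by (simp add: replicate_pmf_Suc_map pmf_bind measure_pmf_single del: replicate_pmf.simps)
qed simp

lemma map_replicate_pmf:
  "map_pmf (map f) (replicate_pmf n p) = replicate_pmf n (map_pmf f p)"
proof (induction n)
  case (Suc n)
  have "map_pmf (map f) (map_pmf ((#) x) (replicate_pmf n p)) =
      map_pmf ((#) (f x)) (map_pmf (map f) (replicate_pmf n p))" for x
    by (simp add: pmf.map_comp o_def)
  then show ?case
    by (simp add: replicate_pmf_Suc_map map_bind_pmf bind_map_pmf Suc.IH del: replicate_pmf.simps)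
qed simp

text \<open>Independence of the letters. With \<open>g\<close> a one-letter phase this makes the
  characteristic function of a sum an \<open>n\<close>-th power.\<close>

lemma expectation_replicate_pmf_prod_list:
  fixes g :: "'a \<Rightarrow> complex"
  assumes "finite (set_pmf p)"
  shows "measure_pmf.expectation (replicate_pmf n p) (\<lambda>xs. prod_list (map g xs)) =
    measure_pmf.expectation p g ^ n"
proof (induction n)
  case (Suc n)
  have "measure_pmf.expectation (replicate_pmf (Suc n) p) (\<lambda>xs. prod_list (map g xs)) =
    (\<Sum>a\<in>set_pmf p. pmf p a *\<^sub>R (g a * measure_pmf.expectation p g ^ n))"
    unfolding replicate_pmf_Suc_map
    by (subst pmf_expectation_bind[OF assms])
      (auto simp: finite_set_replicate_pmf assms Suc.IH)
  also have "\<dots> = measure_pmf.expectation p g * measure_pmf.expectation p g ^ n"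
    by (subst (2) integral_measure_pmf[OF assms]) (auto simp: sum_distrib_right)
  finally show ?case by simp
qed simp

section \<open>Characteristic functions and anti-concentration of i.i.d. sums\<close>

lemma iexp_mult_sum_list:
  "iexp (u * sum_list (map f xs)) = prod_list (map (\<lambda>x. iexp (u * f x)) xs)"
  by (induction xs) (simp_all add: ring_distribs exp_add)

text \<open>Equality in the triangle inequality forces the phases at \<open>a\<close> and \<open>b\<close> to agree.\<close>

lemma norm_char_less_1:
  fixes f :: "'a \<Rightarrow> real"
  assumes fin: "finite (set_pmf p)" and a: "a \<in> set_pmf p" and b: "b \<in> set_pmf p"
    and ne: "iexp (u * f a) \<noteq> iexp (u * f b)"
  shows "norm (measure_pmf.expectation p (\<lambda>x. iexp (u * f x))) < 1"
proof -
  let ?g = "\<lambda>x. pmf p x *\<^sub>R iexp (u * f x)"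
  have ab: "a \<noteq> b" using ne by auto
  have pos: "pmf p a > 0" "pmf p b > 0" using a b by (auto simp: pmf_positive)
  have ng: "norm (?g x) = pmf p x" for x by simp
  have "norm (?g a + ?g b) \<noteq> norm (?g a) + norm (?g b)"
  proof
    assume "norm (?g a + ?g b) = norm (?g a) + norm (?g b)"
    then have "norm (?g a) *\<^sub>R ?g b = norm (?g b) *\<^sub>R ?g a"
      by (simp only: norm_triangle_eq)
    then have "pmf p a *\<^sub>R pmf p b *\<^sub>R iexp (u * f b) = pmf p b *\<^sub>R pmf p a *\<^sub>R iexp (u * f a)"
      unfolding ng .
    with pos ne show False by (simp add: mult.commute)
  qed
  then have lt: "norm (?g a + ?g b) < pmf p a + pmf p b"
    using norm_triangle_ineq[of "?g a" "?g b"] unfolding ng by linarith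
  \<comment> \<open>Polymorphic in the monoid because it serves both the complex sum and the real
    total mass.\<close>
  have split: "sum h (set_pmf p) = h a + h b + sum h (set_pmf p - {a, b})"
    for h :: "'a \<Rightarrow> 'c::comm_monoid_add"
  proof -
    have "sum h (set_pmf p) = sum h {a, b} + sum h (set_pmf p - {a, b})"
      using a b fin by (subst sum.subset_diff[of "{a, b}"]) (auto simp: add.commute)
    then show ?thesis using ab by simp
  qed
  have "measure_pmf.expectation p (\<lambda>x. iexp (u * f x)) =
      ?g a + ?g b + (\<Sum>x\<in>set_pmf p - {a, b}. ?g x)"
    by (subst integral_measure_pmf[OF fin]) (auto simp: split)
  also have "norm \<dots> \<le> norm (?g a + ?g b) + (\<Sum>x\<in>set_pmf p - {a, b}. norm (?g x))"
    by (intro order_trans[OF norm_triangle_ineq] add_left_mono norm_sum)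
  also have "\<dots> < pmf p a + pmf p b + (\<Sum>x\<in>set_pmf p - {a, b}. pmf p x)"
    using lt unfolding ng by simp
  also have "\<dots> = 1"
    using sum_pmf_eq_1[OF fin] by (simp add: split)
  finally show ?thesis .
qed

text \<open>Equal phases force \<open>u * (c - d)\<close> to be an integer multiple of
  \<open>2 * pi\<close>. Countable sets are Lebesgue null, so the strict bound on the characteristic
  function holds almost everywhere.\<close>

lemma countable_iexp_eq:
  fixes c d :: real
  assumes "c \<noteq> d"
  shows "countable {u. iexp (u * c) = iexp (u * d)}"
proof -
  have "{u. iexp (u * c) = iexp (u * d)} \<subseteq> range (\<lambda>n::int. of_int (2 * n) * pi / (c - d))"
  proof
    fix u assume "u \<in> {u. iexp (u * c) = iexp (u * d)}"
    then obtain n :: int where "\<i> * of_real (u * c) = \<i> * of_real (u * d) + (of_int (2 * n) * pi) * \<i>"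
      by (auto simp: exp_eq)
    then have "u * c = u * d + of_int (2 * n) * pi"
      by (auto simp: complex_eq_iff)
    with assms show "u \<in> range (\<lambda>n::int. of_int (2 * n) * pi / (c - d))"
      by (auto simp: field_simps intro!: image_eqI[of _ _ n])
  qed
  then show ?thesis by (rule countable_subset) simp
qed

lemma borel_measurable_char_pmf:
  fixes f :: "'a \<Rightarrow> real"
  assumes "finite (set_pmf p)"
  shows "(\<lambda>u. measure_pmf.expectation p (\<lambda>x. iexp (u * f x))) \<in> borel_measurable borel"
proof -
  have "measure_pmf.expectation p (\<lambda>x. iexp (u * f x)) =
      (\<Sum>x\<in>set_pmf p. pmf p x *\<^sub>R iexp (u * f x))" for u
    by (rule integral_measure_pmf[OF assms]) auto
  then show ?thesis by simp
qed

lemma norm_char_pmf_le_1: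
  "norm (measure_pmf.expectation p (\<lambda>x. iexp (u * f x))) \<le> 1"
  by (intro order_trans[OF integral_norm_bound]) simp

text \<open>
  Averaging the characteristic function of \<open>W - t\<close> against a standard normal variable gives
  the expectation of \<open>exp (- (W - t)\<^sup>2 / 2)\<close>, which dominates the mass of \<open>W\<close> near \<open>t\<close>.
\<close>

lemma prob_near_le_char_power:
  fixes f :: "'a \<Rightarrow> real"
  assumes fin: "finite (set_pmf p)"
  shows "measure_pmf.prob (replicate_pmf n p) {xs. \<bar>sum_list (map f xs) - t\<bar> \<le> c}
    \<le> exp (c\<^sup>2 / 2) *
      (LINT u|std_normal_distribution. norm (measure_pmf.expectation p (\<lambda>x. iexp (u * f x))) ^ n)"
proof -
  interpret N: real_distribution std_normal_distribution by (rule real_dist_normal_dist)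
  let ?Q = "replicate_pmf n p" and ?W = "\<lambda>xs. sum_list (map f xs)"
  let ?\<chi> = "\<lambda>u. measure_pmf.expectation p (\<lambda>x. iexp (u * f x))"
  note finQ = finite_set_replicate_pmf[OF fin, of n]
  have int: "integrable std_normal_distribution (\<lambda>u. iexp (u * s))" for s
    by (rule N.integrable_iexp) auto
  \<comment> \<open>The function \<open>exp (- s\<^sup>2 / 2)\<close> is itself the characteristic
    function of the standard normal law at \<open>s\<close>.\<close>
  have "complex_of_real (measure_pmf.expectation ?Q (\<lambda>xs. exp (- (?W xs - t)\<^sup>2 / 2))) =
      (\<Sum>xs\<in>set_pmf ?Q. pmf ?Q xs *\<^sub>R char std_normal_distribution (?W xs - t))"
    by (subst integral_measure_pmf_real[OF finQ])
      (auto simp: char_std_normal_distribution scaleR_conv_of_real mult.commute)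
  also have "\<dots> = (LINT u|std_normal_distribution.
      (\<Sum>xs\<in>set_pmf ?Q. pmf ?Q xs *\<^sub>R iexp (u * (?W xs - t))))"
    unfolding char_def
    by (subst Bochner_Integration.integral_sum)
      (intro integrable_scaleR_right int, simp add: mult.commute)
  also have "\<dots> = (LINT u|std_normal_distribution. iexp (- (u * t)) * ?\<chi> u ^ n)"
  proof (rule Bochner_Integration.integral_cong[OF refl])
    fix u
    have "(\<Sum>xs\<in>set_pmf ?Q. pmf ?Q xs *\<^sub>R iexp (u * (?W xs - t))) =
        iexp (- (u * t)) * (\<Sum>xs\<in>set_pmf ?Q. pmf ?Q xs *\<^sub>R iexp (u * ?W xs))"
      by (auto simp: sum_distrib_left algebra_simps simp flip: exp_add intro!: sum.cong)
    also have "(\<Sum>xs\<in>set_pmf ?Q. pmf ?Q xs *\<^sub>R iexp (u * ?W xs)) =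
        measure_pmf.expectation ?Q (\<lambda>xs. iexp (u * ?W xs))"
      by (rule integral_measure_pmf[OF finQ, symmetric]) auto
    also have "\<dots> = ?\<chi> u ^ n"
      unfolding iexp_mult_sum_list by (rule expectation_replicate_pmf_prod_list[OF fin])
    finally show "(\<Sum>xs\<in>set_pmf ?Q. pmf ?Q xs *\<^sub>R iexp (u * (?W xs - t))) =
        iexp (- (u * t)) * ?\<chi> u ^ n" .
  qed
  finally have eq: "complex_of_real (measure_pmf.expectation ?Q (\<lambda>xs. exp (- (?W xs - t)\<^sup>2 / 2))) =
      (LINT u|std_normal_distribution. iexp (- (u * t)) * ?\<chi> u ^ n)" .
  \<comment> \<open>Taking norms removes the phase that carries \<open>t\<close>, so the bound is
    uniform in the centre.\<close>
  have "measure_pmf.expectation ?Q (\<lambda>xs. exp (- (?W xs - t)\<^sup>2 / 2)) \<le>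
      norm (complex_of_real (measure_pmf.expectation ?Q (\<lambda>xs. exp (- (?W xs - t)\<^sup>2 / 2))))"
    by simp
  also have "\<dots> \<le> (LINT u|std_normal_distribution. norm (iexp (- (u * t)) * ?\<chi> u ^ n))"
    unfolding eq by (rule integral_norm_bound)
  also have "\<dots> = (LINT u|std_normal_distribution. norm (?\<chi> u) ^ n)"
    by (simp add: norm_mult norm_power)
  finally have le: "measure_pmf.expectation ?Q (\<lambda>xs. exp (- (?W xs - t)\<^sup>2 / 2)) \<le> \<dots>" .
  have "measure_pmf.prob ?Q {xs. \<bar>?W xs - t\<bar> \<le> c} =
      measure_pmf.expectation ?Q (indicator {xs. \<bar>?W xs - t\<bar> \<le> c})"
    by simp
  \<comment> \<open>Within distance \<open>c\<close> of \<open>t\<close> the Gaussian is at least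
    \<open>exp (- c\<^sup>2 / 2)\<close>, whence the constant.\<close>
  also have "\<dots> \<le> measure_pmf.expectation ?Q (\<lambda>xs. exp (c\<^sup>2 / 2) * exp (- (?W xs - t)\<^sup>2 / 2))"
  proof (rule integral_mono)
    fix xs
    have "0 \<le> c\<^sup>2 / 2 - (?W xs - t)\<^sup>2 / 2" if "\<bar>?W xs - t\<bar> \<le> c"
      using power_mono[OF that abs_ge_zero, of 2] by simp
    then show "indicator {xs. \<bar>?W xs - t\<bar> \<le> c} xs \<le> exp (c\<^sup>2 / 2) * exp (- (?W xs - t)\<^sup>2 / 2)"
      by (auto simp: indicator_def simp flip: exp_add)
  qed (auto intro: integrable_measure_pmf_finite finQ)
  also have "\<dots> \<le> exp (c\<^sup>2 / 2) * (LINT u|std_normal_distribution. norm (?\<chi> u) ^ n)"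
    using le by simp
  finally show ?thesis .
qed

text \<open>The powers of a norm below 1 vanish almost everywhere, and dominated convergence applies
  with bound 1. Arbitrary centres \<open>t n\<close> are allowed so that no growth rate of the
  codebook sizes has to be assumed.\<close>

lemma sum_concentration_tendsto_0:
  fixes f :: "'a \<Rightarrow> real"
  assumes fin: "finite (set_pmf p)" and a: "a \<in> set_pmf p" and b: "b \<in> set_pmf p"
    and ne: "f a \<noteq> f b"
  shows "(\<lambda>n. measure_pmf.prob (replicate_pmf n p) {xs. \<bar>sum_list (map f xs) - t n\<bar> \<le> c}) \<longlonglongrightarrow> 0"
proof -
  interpret N: real_distribution std_normal_distribution by (rule real_dist_normal_dist)
  let ?\<chi> = "\<lambda>u. measure_pmf.expectation p (\<lambda>x. iexp (u * f x))"
  have "AE u in lborel. u \<notin> {u. iexp (u * f a) = iexp (u * f b)}"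
    by (intro AE_not_in countable_imp_null_set_lborel countable_iexp_eq ne)
  then have "AE u in lborel. norm (?\<chi> u) < 1"
    by eventually_elim (rule norm_char_less_1[OF fin a b], simp del: of_real_mult)
  then have "AE u in lborel. 0 < ennreal (std_normal_density u) \<longrightarrow> norm (?\<chi> u) < 1"
    by eventually_elim simp
  then have "AE u in std_normal_distribution. norm (?\<chi> u) < 1"
    by (subst AE_density) auto
  then have "AE u in std_normal_distribution. (\<lambda>n. norm (?\<chi> u) ^ n) \<longlonglongrightarrow> 0"
    by eventually_elim (auto intro: LIMSEQ_realpow_zero)
  then have "(\<lambda>n. LINT u|std_normal_distribution. norm (?\<chi> u) ^ n) \<longlonglongrightarrow>
      (LINT u|std_normal_distribution. 0)"
    using borel_measurable_char_pmf[OF fin, of f]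
    by (intro integral_dominated_convergence[where w = "\<lambda>_. 1"])
      (simp_all add: power_le_one norm_char_pmf_le_1 del: of_real_mult)
  then have "(\<lambda>n. exp (c\<^sup>2 / 2) * (LINT u|std_normal_distribution. norm (?\<chi> u) ^ n)) \<longlonglongrightarrow> 0"
    by (auto intro: tendsto_mult_right_zero)
  then show ?thesis
    by (rule tendsto_sandwich[OF _ _ tendsto_const, rotated 2])
      (intro always_eventually allI prob_near_le_char_power[OF fin] measure_nonneg)+
qed

section \<open>Variational distance as overlap, and the one-shot bound\<close>

lemma variational_distance_eq_min:
  assumes fin: "finite A" and "set_pmf p \<subseteq> A" "set_pmf q \<subseteq> A"
  shows "variational_distance A p q = 1 - (\<Sum>a\<in>A. min (pmf p a) (pmf q a))"
proof -
  have "(\<Sum>a\<in>A. \<bar>pmf p a - pmf q a\<bar>) =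
      (\<Sum>a\<in>A. pmf p a + pmf q a - 2 * min (pmf p a) (pmf q a))"
    by (intro sum.cong) auto
  also have "\<dots> = 2 - 2 * (\<Sum>a\<in>A. min (pmf p a) (pmf q a))"
    using assms by (simp add: sum.distrib sum_subtractf sum_pmf_eq_1 flip: sum_distrib_left)
  finally show ?thesis by (simp add: variational_distance_def)
qed

text \<open>Fibres of \<open>F\<close> are disjoint; this turns pointwise overlap bounds into
  probabilities of events.\<close>

lemma sum_prob_fibres_le:
  assumes "finite A"
  shows "(\<Sum>a\<in>A. measure_pmf.prob Q {\<omega>. F \<omega> = a \<and> S \<omega>}) \<le> measure_pmf.prob Q {\<omega>. S \<omega>}"
proof -
  have "(\<Sum>a\<in>A. measure_pmf.prob Q {\<omega>. F \<omega> = a \<and> S \<omega>}) =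
      measure_pmf.prob Q (\<Union>a\<in>A. {\<omega>. F \<omega> = a \<and> S \<omega>})"
    using assms
    by (intro measure_pmf.finite_measure_finite_Union[symmetric]) (auto simp: disjoint_family_on_def)
  also have "\<dots> \<le> measure_pmf.prob Q {\<omega>. S \<omega>}"
    by (intro measure_pmf.finite_measure_mono) auto
  finally show ?thesis .
qed

text \<open>
  On correctly decoded pairs \<open>(m, z)\<close> determines \<open>x = \<psi> m z\<close>.  Hence, up to the decoding error, the
  overlap of the two laws at \<open>(m, z)\<close> is at most \<open>P\<^sub>Z(z) min (P(x|z), 1/M)\<close>, and this is a factor
  \<open>exp (- c)\<close> below one of the two laws unless \<open>ln (1 / P(x|z))\<close> is within \<open>c\<close> of \<open>ln M\<close>.
\<close>

lemma variational_distance_uniform_ge: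
  fixes Q :: "('x \<times> 'z) pmf" and \<phi> :: "'x \<Rightarrow> nat" and \<psi> :: "nat \<Rightarrow> 'z \<Rightarrow> 'x"
  assumes finB: "finite B" and B: "\<And>x z. (x, z) \<in> set_pmf Q \<Longrightarrow> z \<in> B"
    and \<phi>: "\<And>x z. (x, z) \<in> set_pmf Q \<Longrightarrow> \<phi> x \<in> {1..M}"
  shows "variational_distance ({1..M} \<times> B) (map_pmf (\<lambda>(x, z). (\<phi> x, z)) Q)
      (pair_pmf (pmf_of_set {1..M}) (map_pmf snd Q)) \<ge>
    1 - measure_pmf.prob Q {(x, z). \<psi> (\<phi> x) z \<noteq> x} - 2 * exp (- c) -
      measure_pmf.prob Q {(x, z). \<bar>ln (pmf (map_pmf snd Q) z / pmf Q (x, z)) - ln M\<bar> \<le> c}"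
proof -
  define A where "A = {1..M} \<times> B"
  define p where "p = map_pmf (\<lambda>(x, z). (\<phi> x, z)) Q"
  define qz where "qz = map_pmf snd Q"
  define u where "u = pair_pmf (pmf_of_set {1..M}) qz"
  define F where "F = (\<lambda>(x, z). (\<phi> x, z :: 'z))"
  define ok where "ok = (\<lambda>(x, z). \<psi> (\<phi> x) z = x)"
  define near where "near = (\<lambda>(x, z). \<bar>ln (pmf qz z / pmf Q (x, z)) - ln M\<bar> \<le> c)"
  \<comment> \<open>The mass of \<open>p\<close> at \<open>a\<close> is split into undecodable and
    decodable parts \<open>err a\<close> and \<open>g a\<close>; \<open>h a\<close> is the share of
    \<open>g a\<close> with information density near \<open>ln M\<close>.\<close>
  define err where "err a = measure_pmf.prob Q {\<omega>. F \<omega> = a \<and> \<not> ok \<omega>}" for a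
  define g where "g a = measure_pmf.prob Q {\<omega>. F \<omega> = a \<and> ok \<omega>}" for a
  define h where "h a = measure_pmf.prob Q {\<omega>. F \<omega> = a \<and> ok \<omega> \<and> near \<omega>}" for a
  have "{1..M} \<noteq> {}" using \<phi> set_pmf_not_empty[of Q] by fastforce
  then have M: "M > 0" and ne: "{1..M} \<noteq> {}" by auto
  have finA: "finite A" using finB by (simp add: A_def)
  have pA: "set_pmf p \<subseteq> A" using \<phi> B by (fastforce simp: p_def A_def)
  have uA: "set_pmf u \<subseteq> A" using B ne by (auto simp: u_def A_def qz_def set_pmf_of_set)
  have p_split: "pmf p a = err a + g a" for a
  proof -
    have "pmf p a = measure_pmf.prob Q ({\<omega>. F \<omega> = a \<and> \<not> ok \<omega>} \<union> {\<omega>. F \<omega> = a \<and> ok \<omega>})"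
      unfolding p_def F_def[symmetric] pmf_map
      by (intro arg_cong[of _ _ "measure_pmf.prob Q"]) auto
    then show ?thesis
      unfolding err_def g_def by (subst (asm) measure_pmf.finite_measure_Union) auto
  qed
  have nonneg: "err a \<ge> 0" "g a \<ge> 0" "h a \<ge> 0" "pmf u a \<ge> 0" for a
    by (simp_all add: err_def g_def h_def)
  have overlap: "min (pmf p a) (pmf u a) \<le> err a + exp (- c) * pmf u a + exp (- c) * g a + h a"
    if a: "a \<in> A" for a
  proof -
    obtain m z where mz: "a = (m, z)" by force
    have extra: "0 \<le> exp (- c) * pmf u a" "0 \<le> exp (- c) * g a" using nonneg by simp_all
    show ?thesis
    proof (cases "g a = 0")
      case True
      then show ?thesis using extra nonneg[of a] p_split[of a] by linarith
    next
      case False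
      \<comment> \<open>The decoder recovers the source word from \<open>(m, z)\<close>, so the
        correctly decoded fibre is a single point and \<open>g a\<close> is a point mass of
        \<open>Q\<close>.\<close>
      have sub: "{\<omega>. F \<omega> = a \<and> ok \<omega>} \<subseteq> {(\<psi> m z, z)}"
        by (auto simp: F_def ok_def mz)
      have "{\<omega>. F \<omega> = a \<and> ok \<omega>} \<noteq> {}" using False unfolding g_def by (metis measure_empty)
      with sub have single: "{\<omega>. F \<omega> = a \<and> ok \<omega>} = {(\<psi> m z, z)}" by blast
      then have g: "g a = pmf Q (\<psi> m z, z)" by (simp add: g_def measure_pmf_single)
      with False have gpos: "g a > 0" using nonneg(2)[of a] by simp
      then have "(\<psi> m z, z) \<in> set_pmf Q" by (simp add: g set_pmf_iff)
      then have "z \<in> set_pmf qz" by (force simp: qz_def)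
      then have zpos: "pmf qz z > 0" by (rule pmf_positive)
      have u: "pmf u a = pmf qz z / M"
        using a M by (auto simp: u_def mz A_def pmf_pair pmf_of_set)
      have upos: "pmf u a > 0" using zpos M by (simp add: u)
      have R: "ln (pmf qz z / pmf Q (\<psi> m z, z)) - ln M = ln (pmf u a) - ln (g a)"
        using zpos gpos M by (simp add: u g[symmetric] ln_div)
      \<comment> \<open>Either the two masses are comparable, or one is smaller by a factor
        \<open>exp (- c)\<close>; the minimum is bounded accordingly.\<close>
      consider "\<bar>ln (pmf u a) - ln (g a)\<bar> \<le> c" | "ln (g a) \<le> - c + ln (pmf u a)"
        | "ln (pmf u a) \<le> - c + ln (g a)" by linarith
      then show ?thesis
      proof cases
        case 1
        then have n: "near (\<psi> m z, z)" by (simp add: near_def R)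
        have "near \<omega>" if "F \<omega> = a \<and> ok \<omega>" for \<omega>
        proof -
          have "\<omega> \<in> {(\<psi> m z, z)}" using that unfolding single[symmetric] by (rule CollectI)
          with n show ?thesis by simp
        qed
        then have "{\<omega>. F \<omega> = a \<and> ok \<omega> \<and> near \<omega>} = {\<omega>. F \<omega> = a \<and> ok \<omega>}"
          by metis
        then have "h a = g a" by (simp add: h_def g_def)
        then show ?thesis using extra p_split[of a] by linarith
      next
        case 2
        then have "exp (ln (g a)) \<le> exp (- c + ln (pmf u a))" by simp
        then have "g a \<le> exp (- c) * pmf u a" using gpos upos by (simp only: exp_add exp_ln)
        then show ?thesis using extra p_split[of a] nonneg[of a] by linarith
      next
        case 3
        then have "exp (ln (pmf u a)) \<le> exp (- c + ln (g a))" by simp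
        then have "pmf u a \<le> exp (- c) * g a" using gpos upos by (simp only: exp_add exp_ln)
        then show ?thesis using extra nonneg[of a] by linarith
      qed
    qed
  qed
  have "(\<Sum>a\<in>A. min (pmf p a) (pmf u a)) \<le>
      (\<Sum>a\<in>A. err a + exp (- c) * pmf u a + exp (- c) * g a + h a)"
    by (intro sum_mono overlap)
  also have "\<dots> = sum err A + exp (- c) * sum (pmf u) A + exp (- c) * sum g A + sum h A"
    by (simp add: sum.distrib sum_distrib_left)
  \<comment> \<open>Both \<open>pmf u\<close> and \<open>g\<close> have total mass at most 1, which
    gives the term \<open>2 * exp (- c)\<close>.\<close>
  also have "\<dots> \<le> measure_pmf.prob Q {\<omega>. \<not> ok \<omega>} + exp (- c) * 1 + exp (- c) * 1 +
      measure_pmf.prob Q {\<omega>. near \<omega>}"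
  proof (intro add_mono mult_left_mono)
    show "sum err A \<le> measure_pmf.prob Q {\<omega>. \<not> ok \<omega>}"
      unfolding err_def by (rule sum_prob_fibres_le[OF finA])
    show "sum (pmf u) A \<le> 1" using sum_pmf_eq_1[OF finA uA] by simp
    have "sum g A \<le> measure_pmf.prob Q {\<omega>. ok \<omega>}"
      unfolding g_def by (rule sum_prob_fibres_le[OF finA])
    then show "sum g A \<le> 1" by (rule order_trans) simp
    have "sum h A \<le> measure_pmf.prob Q {\<omega>. ok \<omega> \<and> near \<omega>}"
      unfolding h_def by (rule sum_prob_fibres_le[OF finA])
    also have "\<dots> \<le> measure_pmf.prob Q {\<omega>. near \<omega>}"
      by (intro measure_pmf.finite_measure_mono) auto
    finally show "sum h A \<le> measure_pmf.prob Q {\<omega>. near \<omega>}" .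
  qed simp_all
  finally have le: "(\<Sum>a\<in>A. min (pmf p a) (pmf u a)) \<le> measure_pmf.prob Q {\<omega>. \<not> ok \<omega>} +
      2 * exp (- c) + measure_pmf.prob Q {\<omega>. near \<omega>}"
    by simp
  have sets: "{\<omega>. \<not> ok \<omega>} = {(x, z). \<psi> (\<phi> x) z \<noteq> x}"
    "{\<omega>. near \<omega>} = {(x, z). \<bar>ln (pmf qz z / pmf Q (x, z)) - ln M\<bar> \<le> c}"
    by (auto simp: ok_def near_def)
  have "variational_distance A p u = 1 - (\<Sum>a\<in>A. min (pmf p a) (pmf u a))"
    by (rule variational_distance_eq_min[OF finA pA uA])
  then show ?thesis
    using le unfolding sets unfolding A_def p_def u_def qz_def by linarith
qed

section \<open>From the one-shot bound to block codes\<close>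

lemma variance_pos_imp_not_constant:
  fixes f :: "'a \<Rightarrow> real"
  assumes "measure_pmf.variance p f > 0"
  obtains a b where "a \<in> set_pmf p" "b \<in> set_pmf p" "f a \<noteq> f b"
proof (rule ccontr)
  assume no: "\<not> thesis"
  note witness = that
  obtain a where a: "a \<in> set_pmf p" using set_pmf_not_empty[of p] by blast
  have const: "f x = f a" if "x \<in> set_pmf p" for x
    using no witness[OF a that] by metis
  have "measure_pmf.expectation p f = measure_pmf.expectation p (\<lambda>_. f a)"
    by (intro integral_cong_AE) (auto simp: AE_measure_pmf_iff const)
  then have m: "measure_pmf.expectation p f = f a" by simp
  have "measure_pmf.variance p f = measure_pmf.expectation p (\<lambda>_. 0)"
    unfolding m by (intro integral_cong_AE) (auto simp: AE_measure_pmf_iff const)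
  with assms show False by simp
qed

lemma prod_list_pmf_pos:
  assumes "set xs \<subseteq> set_pmf p"
  shows "prod_list (map (pmf p) xs) > 0"
  using assms by (induction xs) (auto simp: pmf_positive)

text \<open>Both block laws are products, so the log ratio splits letter by letter; on the support
  all factors are positive.\<close>

lemma ln_prod_cond_prob:
  assumes "set xzs \<subseteq> set_pmf P"
  shows "ln (prod_list (map (pmf (map_pmf snd P)) (map snd xzs)) / prod_list (map (pmf P) xzs)) =
    sum_list (map (\<lambda>(x, z). ln (1 / cond_prob P x z)) xzs)"
  using assms
proof (induction xzs)
  case (Cons y ys)
  obtain x z where y: "y = (x, z)" by force
  then have "(x, z) \<in> set_pmf P" "z \<in> set_pmf (map_pmf snd P)"
    using Cons.prems by force+
  then have pos: "pmf P (x, z) > 0" "pmf (map_pmf snd P) z > 0"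
    by (auto simp only: intro: pmf_positive)
  have "set (map snd ys) \<subseteq> set_pmf (map_pmf snd P)" "set ys \<subseteq> set_pmf P"
    using Cons.prems by auto
  note pos = pos this[THEN prod_list_pmf_pos]
  then show ?case
    using Cons by (simp add: y cond_prob_def ln_div ln_mult)
qed simp

text \<open>Passing from a list of pairs to a pair of lists preserves point masses.\<close>

lemma inj_unzip: "inj (\<lambda>xzs. (map fst xzs, map snd xzs))"
  by (rule injI) (metis prod.inject zip_map_fst_snd)

lemma security_distance_ge:
  fixes P :: "('x::finite \<times> 'z::finite) pmf"
  assumes code: "slepian_wolf_code n M \<phi> \<psi>"
  shows "security_distance P n M \<phi> \<ge> 1 - error_prob P n \<phi> \<psi> - 2 * exp (- c) -
    measure_pmf.prob (replicate_pmf n P)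
      {xzs. \<bar>sum_list (map (\<lambda>(x, z). ln (1 / cond_prob P x z)) xzs) - ln M\<bar> \<le> c}"
proof -
  let ?R = "replicate_pmf n P" and ?unzip = "\<lambda>xzs :: ('x \<times> 'z) list. (map fst xzs, map snd xzs)"
  define Q where "Q = map_pmf ?unzip ?R"
  have len: "length xzs = n" if "xzs \<in> set_pmf ?R" for xzs
    using that by (simp add: set_replicate_pmf)
  have Qz: "map_pmf snd Q = map_pmf (map snd) ?R"
    and S: "map_pmf (\<lambda>(x, z). (\<phi> x, z)) Q = map_pmf (\<lambda>xzs. (\<phi> (map fst xzs), map snd xzs)) ?R"
    by (simp_all add: Q_def pmf.map_comp o_def)
  have fin: "finite {zs :: 'z list. length zs = n}"
    using finite_lists_length_eq[of "UNIV :: 'z set" n] by simp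
  have R: "ln (pmf (map_pmf snd Q) (map snd xzs) / pmf Q (?unzip xzs)) =
      sum_list (map (\<lambda>(x, z). ln (1 / cond_prob P x z)) xzs)" if "xzs \<in> set_pmf ?R" for xzs
  proof -
    have "pmf Q (?unzip xzs) = pmf ?R xzs"
      unfolding Q_def by (rule pmf_map_inj'[OF inj_unzip])
    moreover have "pmf ?R xzs = prod_list (map (pmf P) xzs)"
      using pmf_replicate_pmf[of xzs P] len[OF that] by simp
    moreover have "pmf (map_pmf snd Q) (map snd xzs) =
        prod_list (map (pmf (map_pmf snd P)) (map snd xzs))"
      using pmf_replicate_pmf[of "map snd xzs" "map_pmf snd P"] len[OF that]
      by (simp add: Qz map_replicate_pmf)
    moreover have "set xzs \<subseteq> set_pmf P"
      using that by (auto simp: set_replicate_pmf)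
    ultimately show ?thesis by (simp only: ln_prod_cond_prob)
  qed
  have "variational_distance ({1..M} \<times> {zs. length zs = n}) (map_pmf (\<lambda>(x, z). (\<phi> x, z)) Q)
      (pair_pmf (pmf_of_set {1..M}) (map_pmf snd Q)) \<ge>
    1 - measure_pmf.prob Q {(x, z). \<psi> (\<phi> x) z \<noteq> x} - 2 * exp (- c) -
      measure_pmf.prob Q {(x, z). \<bar>ln (pmf (map_pmf snd Q) z / pmf Q (x, z)) - ln M\<bar> \<le> c}"
    using code fin len
    by (intro variational_distance_uniform_ge) (auto simp: Q_def slepian_wolf_code_def)
  moreover have "measure_pmf.prob Q {(x, z). \<psi> (\<phi> x) z \<noteq> x} = error_prob P n \<phi> \<psi>"
    by (simp add: Q_def error_prob_def vimage_def)
  moreover have "measure_pmf.prob Q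
      {(x, z). \<bar>ln (pmf (map_pmf snd Q) z / pmf Q (x, z)) - ln M\<bar> \<le> c} =
    measure_pmf.prob ?R {xzs. \<bar>ln (pmf (map_pmf snd Q) (map snd xzs) / pmf Q (?unzip xzs)) - ln M\<bar> \<le> c}"
    by (subst (1) Q_def) (simp add: vimage_def)
  \<comment> \<open>The letterwise formula is available only on the support, hence equality of the
    events almost everywhere.\<close>
  moreover have "\<dots> = measure_pmf.prob ?R
      {xzs. \<bar>sum_list (map (\<lambda>(x, z). ln (1 / cond_prob P x z)) xzs) - ln M\<bar> \<le> c}"
    by (intro measure_pmf.finite_measure_eq_AE) (auto simp: AE_measure_pmf_iff R)
  ultimately show ?thesis
    unfolding security_distance_def S Qz by linarith
qed

lemma security_distance_le_1:
  fixes P :: "('x::finite \<times> 'z::finite) pmf"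
  assumes code: "slepian_wolf_code n M \<phi> \<psi>"
  shows "security_distance P n M \<phi> \<le> 1"
proof -
  \<comment> \<open>Any word of length \<open>n\<close> witnesses that the message set is nonempty,
    as \<open>pmf_of_set\<close> requires.\<close>
  have "\<phi> (replicate n undefined) \<in> {1..M}" using code by (simp add: slepian_wolf_code_def)
  then have ne: "{1..M} \<noteq> {}" by auto
  have fin: "finite ({1..M} \<times> {zs :: 'z list. length zs = n})"
    using finite_lists_length_eq[of "UNIV :: 'z set" n] by simp
  show ?thesis
    unfolding security_distance_def using code ne
    by (subst variational_distance_eq_min[OF fin])
      (auto simp: slepian_wolf_code_def set_replicate_pmf intro!: sum_nonneg)
qed

theorem corollary12:
  fixes P :: "('x::finite \<times> 'z::finite) pmf"
    and M :: "nat \<Rightarrow> nat"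
    and \<phi> :: "nat \<Rightarrow> 'x list \<Rightarrow> nat"
    and \<psi> :: "nat \<Rightarrow> nat \<Rightarrow> 'z list \<Rightarrow> 'x list"
  assumes "cond_information_variance P > 0"
    and "\<And>n. n \<ge> 1 \<Longrightarrow> slepian_wolf_code n (M n) (\<phi> n) (\<psi> n)"
    and "(\<lambda>n. error_prob P n (\<phi> n) (\<psi> n)) \<longlonglongrightarrow> 0"
  shows "(\<lambda>n. security_distance P n (M n) (\<phi> n)) \<longlonglongrightarrow> 1"
proof (rule order_tendstoI)
  fix y :: real assume "1 < y"
  have "\<forall>\<^sub>F n in sequentially. security_distance P n (M n) (\<phi> n) \<le> 1"
    using eventually_ge_at_top[of 1]
    by eventually_elim (rule security_distance_le_1[OF assms(2)])
  then show "\<forall>\<^sub>F n in sequentially. security_distance P n (M n) (\<phi> n) < y"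
    by eventually_elim (use \<open>1 < y\<close> in linarith)
next
  fix y :: real assume y: "y < 1"
  \<comment> \<open>Makes \<open>2 * exp (- c)\<close> equal to \<open>(1 - y) / 2\<close>, so the
    lower bound tends to \<open>(1 + y) / 2\<close>, which exceeds \<open>y\<close>.\<close>
  define c where "c = - ln ((1 - y) / 4)"
  define near where "near n = measure_pmf.prob (replicate_pmf n P)
    {xzs. \<bar>sum_list (map (\<lambda>(x, z). ln (1 / cond_prob P x z)) xzs) - ln (M n)\<bar> \<le> c}" for n
  obtain a b where "a \<in> set_pmf P" "b \<in> set_pmf P"
    "(\<lambda>(x, z). ln (1 / cond_prob P x z)) a \<noteq> (\<lambda>(x, z). ln (1 / cond_prob P x z)) b"
    using assms(1) unfolding cond_information_variance_def by (rule variance_pos_imp_not_constant)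
  then have "near \<longlonglongrightarrow> 0"
    unfolding near_def by (intro sum_concentration_tendsto_0) auto
  then have "(\<lambda>n. 1 - error_prob P n (\<phi> n) (\<psi> n) - 2 * exp (- c) - near n) \<longlonglongrightarrow>
      1 - 0 - 2 * exp (- c) - 0"
    by (intro tendsto_intros assms(3))
  moreover have "y < 1 - 0 - 2 * exp (- c) - 0"
    using y by (simp add: c_def field_simps)
  ultimately have "\<forall>\<^sub>F n in sequentially.
      y < 1 - error_prob P n (\<phi> n) (\<psi> n) - 2 * exp (- c) - near n"
    by (rule order_tendstoD(1))
  then show "\<forall>\<^sub>F n in sequentially. y < security_distance P n (M n) (\<phi> n)"
    using eventually_ge_at_top[of 1]
  proof eventually_elim
    case (elim n)
    then show ?case
      using security_distance_ge[OF assms(2)[of n], of P c] unfolding near_def by linarith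
  qed
qed

end
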